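(* For every $g\in\mathbb{R}^T$, the following statements are equivalent: (a) $\mathrm{OPT}(g)=\mathrm{SOL}(A)$ for some $A\subseteq T$, (b) $\mathrm{OPT}(g)=\mathrm{OPT}(f)$ for some optimal solution $f$ of the problem $(\mathrm{P}_g)$: $\min\{B(f')\mid f'\in\mathbb{R}^T\text{ is a super-reparametrization of }g\}$. If both statements are true, then the equality in (a) holds, e.g., for $A=A_{\min}(\mathrm{OPT}(g))$, and the equality in (b) holds, e.g., for $f$ optimal for $(\mathrm{P}_g)$ with $A^*(f)=A_{\min}(\mathrm{OPT}(g))$.
   Context: Fix a structure $(D,V,C)$: $V$ is a finite set of variables, $D$ a finite nonempty domain, $C\subseteq 2^V$ a set of non-empty subsets of $V$ (scopes). For $S\subseteq V$, $D^S$ is the set of maps $S\to D$; for an assignment $x\in D^V$, $x[S]\in D^S$ is its restriction to $S$. Tuples: $T_S=\{(S,k)\mid k\in D^S\}$ for $S\in C$ and $T=\bigcup_{S\in C}T_S$. A CSP is a subset $A\subseteq T$ (of allowed tuples); its solution set is $\mathrm{SOL}(A)=\{x\in D^V\mid (S,x[S])\in A\ \forall S\in C\}$. For $X\subseteq D^V$, the minimal CSP for $X$ is $A_{\min}(X)=\bigcap\{A\subseteq T\mid X\subseteq\mathrm{SOL}(A)\}$. A WCSP is a vector $f\in\mathbb{R}^T$. The map $\phi\colon D^V\to\{0,1\}^T$ is defined by $\phi_{(S,k)}(x)=1$ if $x[S]=k$ and $0$ otherwise, so the WCSP objective is $\langle f,\phi(x)\rangle=\sum_{S\in C}f_{(S,x[S])}$.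 $\mathrm{OPT}(f)=\operatorname{argmax}_{x\in D^V}\langle f,\phi(x)\rangle\subseteq D^V$ is the set of optimal assignments. A WCSP $f$ is a super-reparametrization of $g$ if $\langle f,\phi(x)\rangle\ge\langle g,\phi(x)\rangle$ for all $x\in D^V$. Upper bound: $B(f)=\sum_{S\in C}\max_{t\in T_S}f_t$. A tuple $t\in T_S$ is active for $f$ if $f_t=\max_{t'\in T_S}f_{t'}$; $A^*(f)\subseteq T$ is the set of all tuples active for $f$, viewed as a CSP. *)

theory Defs
  imports Complex_Main "HOL-Library.FuncSet"
begin

text \<open>
  The set \<open>X\<^sup>Y\<close> of maps from \<open>Y\<close> to \<open>X\<close> is always rendered as the extensional function space
  \<open>Y \<rightarrow>\<^sub>E X\<close>, so that equality of maps is HOL equality.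
\<close>

type_synonym ('v, 'd) tup = "'v set \<times> ('v \<Rightarrow> 'd)"

definition assignments :: "'d set \<Rightarrow> 'v set \<Rightarrow> ('v \<Rightarrow> 'd) set" where
  "assignments D V = V \<rightarrow>\<^sub>E D"

definition scope_tuples :: "'d set \<Rightarrow> 'v set \<Rightarrow> ('v, 'd) tup set" where
  "scope_tuples D S = {(S, k) | k. k \<in> S \<rightarrow>\<^sub>E D}"

definition tuples :: "'d set \<Rightarrow> 'v set set \<Rightarrow> ('v, 'd) tup set" where
  "tuples D C = (\<Union>S\<in>C. scope_tuples D S)"

definition SOL :: "'d set \<Rightarrow> 'v set \<Rightarrow> 'v set set \<Rightarrow> ('v, 'd) tup set \<Rightarrow> ('v \<Rightarrow> 'd) set" where
  "SOL D V C A = {x \<in> assignments D V. \<forall>S\<in>C. (S, restrict x S) \<in> A}"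

definition A_min :: "'d set \<Rightarrow> 'v set \<Rightarrow> 'v set set \<Rightarrow> ('v \<Rightarrow> 'd) set \<Rightarrow> ('v, 'd) tup set" where
  "A_min D V C X = \<Inter>{A. A \<subseteq> tuples D C \<and> X \<subseteq> SOL D V C A}"

definition wcsps :: "'d set \<Rightarrow> 'v set set \<Rightarrow> (('v, 'd) tup \<Rightarrow> real) set" where
  "wcsps D C = tuples D C \<rightarrow>\<^sub>E UNIV"

definition phi :: "'d set \<Rightarrow> 'v set set \<Rightarrow> ('v \<Rightarrow> 'd) \<Rightarrow> ('v, 'd) tup \<Rightarrow> real" where
  "phi D C x = (\<lambda>(S, k)\<in>tuples D C. if restrict x S = k then 1 else 0)"

definition inner_prod ::
  "'d set \<Rightarrow> 'v set set \<Rightarrow> (('v, 'd) tup \<Rightarrow> real) \<Rightarrow> (('v, 'd) tup \<Rightarrow> real) \<Rightarrow> real" where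
  "inner_prod D C f h = (\<Sum>t\<in>tuples D C. f t * h t)"

definition OPT ::
  "'d set \<Rightarrow> 'v set \<Rightarrow> 'v set set \<Rightarrow> (('v, 'd) tup \<Rightarrow> real) \<Rightarrow> ('v \<Rightarrow> 'd) set" where
  "OPT D V C f =
     {x. is_arg_max (\<lambda>y. inner_prod D C f (phi D C y)) (\<lambda>y. y \<in> assignments D V) x}"

definition super_reparametrization ::
  "'d set \<Rightarrow> 'v set \<Rightarrow> 'v set set \<Rightarrow> (('v, 'd) tup \<Rightarrow> real) \<Rightarrow> (('v, 'd) tup \<Rightarrow> real) \<Rightarrow> bool" where
  "super_reparametrization D V C f g \<longleftrightarrow>
     (\<forall>x\<in>assignments D V. inner_prod D C f (phi D C x) \<ge> inner_prod D C g (phi D C x))"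

definition upper_bound :: "'d set \<Rightarrow> 'v set set \<Rightarrow> (('v, 'd) tup \<Rightarrow> real) \<Rightarrow> real" where
  "upper_bound D C f = (\<Sum>S\<in>C. Max (f ` scope_tuples D S))"

definition active_tuples ::
  "'d set \<Rightarrow> 'v set set \<Rightarrow> (('v, 'd) tup \<Rightarrow> real) \<Rightarrow> ('v, 'd) tup set" where
  "active_tuples D C f =
     {t. \<exists>S\<in>C. t \<in> scope_tuples D S \<and> f t = Max (f ` scope_tuples D S)}"

definition optimal_solution ::
  "'d set \<Rightarrow> 'v set \<Rightarrow> 'v set set \<Rightarrow> (('v, 'd) tup \<Rightarrow> real) \<Rightarrow> (('v, 'd) tup \<Rightarrow> real) \<Rightarrow> bool" where
  "optimal_solution D V C g f \<longleftrightarrow>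
     is_arg_min (upper_bound D C)
       (\<lambda>f'. f' \<in> wcsps D C \<and> super_reparametrization D V C f' g) f"

end

theory Submission
  imports Defs
begin

text \<open>
  A super-reparametrization \<open>f\<close> of \<open>g\<close> satisfies
  \<open>B(f) \<ge> max\<^sub>x \<langle>f, \<phi>(x)\<rangle> \<ge> max\<^sub>x \<langle>g, \<phi>(x)\<rangle>\<close>, and spreading the last maximum \<open>M\<close> evenly over the
  scopes attains equality, so the optimal value of \<open>(P\<^sub>g)\<close> is \<open>M\<close>. Hence for optimal \<open>f\<close> the bound
  \<open>B(f)\<close> is attained, and it is attained precisely by the solutions of the active-tuple CSP:
  \<open>OPT(f) = SOL(A*(f))\<close>. Conversely, lowering the evenly spread WCSP slightly on all tuples outside
  \<open>A\<^sub>m\<^sub>i\<^sub>n(OPT(g))\<close> keeps it a super-reparametrization, because the non-optimal values of \<open>g\<close> are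
  bounded away from \<open>M\<close>.
\<close>

locale csp_structure =
  fixes D :: "'d set" and V :: "'v set" and C :: "'v set set"
  assumes finite_V: "finite V" and finite_D: "finite D" and D_nonempty: "D \<noteq> {}"
    and C_subset: "C \<subseteq> Pow V"
begin

section \<open>Finiteness, and restriction of assignments to scopes\<close>

lemma finite_C: "finite C"
  using C_subset finite_V by (meson finite_Pow_iff finite_subset)

lemma finite_scope: "S \<in> C \<Longrightarrow> finite S"
  using C_subset finite_V by (meson PowD finite_subset subsetD)

lemma finite_assignments: "finite (assignments D V)"
  unfolding assignments_def using finite_V finite_D by (simp add: finite_PiE)

lemma assignments_nonempty: "assignments D V \<noteq> {}"
  unfolding assignments_def using D_nonempty by (simp add: PiE_eq_empty_iff)

lemma finite_scope_tuples: "S \<in> C \<Longrightarrow> finite (scope_tuples D S)"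
  unfolding scope_tuples_def using finite_scope finite_D by (simp add: finite_PiE)

lemma restrict_scope_tuples:
  "x \<in> assignments D V \<Longrightarrow> S \<in> C \<Longrightarrow> (S, restrict x S) \<in> scope_tuples D S"
  unfolding scope_tuples_def assignments_def using C_subset by fastforce

lemma scope_tuples_subset: "S \<in> C \<Longrightarrow> scope_tuples D S \<subseteq> tuples D C"
  unfolding tuples_def by blast

section \<open>The objective as a sum over scopes, and its maximisers\<close>

definition objective :: "(('v, 'd) tup \<Rightarrow> real) \<Rightarrow> ('v \<Rightarrow> 'd) \<Rightarrow> real" where
  "objective f x = (\<Sum>S\<in>C. f (S, restrict x S))"

text \<open>Splitting the tuples by scope turns the inner product into a double sum; in each scope
  the indicator selects the single tuple \<open>(S, restrict x S)\<close>.\<close>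

lemma inner_prod_phi:
  assumes "x \<in> assignments D V"
  shows "inner_prod D C f (phi D C x) = objective f x"
proof -
  have T: "tuples D C = (SIGMA S:C. S \<rightarrow>\<^sub>E D)"
    unfolding tuples_def scope_tuples_def by auto
  have "inner_prod D C f (phi D C x) =
      (\<Sum>(S, k)\<in>(SIGMA S:C. S \<rightarrow>\<^sub>E D). f (S, k) * (if restrict x S = k then 1 else 0))"
    unfolding inner_prod_def phi_def T by (rule sum.cong) auto
  also have "\<dots> = (\<Sum>S\<in>C. \<Sum>k\<in>S \<rightarrow>\<^sub>E D. f (S, k) * (if restrict x S = k then 1 else 0))"
    using finite_C finite_scope finite_D by (subst sum.Sigma) (auto intro!: finite_PiE)
  also have "\<dots> = (\<Sum>S\<in>C. f (S, restrict x S))"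
  proof (rule sum.cong)
    fix S assume S: "S \<in> C"
    have "finite (S \<rightarrow>\<^sub>E D)" "restrict x S \<in> S \<rightarrow>\<^sub>E D"
      using restrict_scope_tuples[OF assms S] finite_scope[OF S] finite_D
      by (auto simp: scope_tuples_def intro!: finite_PiE)
    then show "(\<Sum>k\<in>S \<rightarrow>\<^sub>E D. f (S, k) * (if restrict x S = k then 1 else 0)) = f (S, restrict x S)"
      by (simp add: if_distrib cong: if_cong)
  qed simp
  finally show ?thesis
    unfolding objective_def .
qed

lemma OPT_iff:
  "x \<in> OPT D V C f \<longleftrightarrow>
     x \<in> assignments D V \<and> (\<forall>y\<in>assignments D V. objective f y \<le> objective f x)"
  unfolding OPT_def is_arg_max_linorder by (auto simp: inner_prod_phi)

lemma OPT_subset: "OPT D V C g \<subseteq> assignments D V"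
  by (auto simp: OPT_iff)

lemma OPT_nonempty: "OPT D V C f \<noteq> {}"
proof -
  have "finite (objective f ` assignments D V)" "objective f ` assignments D V \<noteq> {}"
    using finite_assignments assignments_nonempty by auto
  from Max_in[OF this] obtain x where
    x: "x \<in> assignments D V" "Max (objective f ` assignments D V) = objective f x"
    by auto
  then have "x \<in> OPT D V C f"
    unfolding OPT_iff using finite_assignments by (metis Max_ge finite_imageI imageI)
  then show ?thesis
    by blast
qed

lemma super_reparametrization_iff:
  "super_reparametrization D V C f g \<longleftrightarrow> (\<forall>x\<in>assignments D V. objective g x \<le> objective f x)"
  unfolding super_reparametrization_def by (simp add: inner_prod_phi)

section \<open>The upper bound and the active tuples\<close>

lemma le_Max_scope:
  "t \<in> scope_tuples D S \<Longrightarrow> S \<in> C \<Longrightarrow> f t \<le> Max (f ` scope_tuples D S)"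
  by (simp add: finite_scope_tuples)

lemma objective_le_upper_bound:
  "x \<in> assignments D V \<Longrightarrow> objective f x \<le> upper_bound D C f"
  unfolding objective_def upper_bound_def
  by (intro sum_mono le_Max_scope restrict_scope_tuples)

lemma mem_active_tuples_iff:
  assumes "S \<in> C"
  shows "(S, k) \<in> active_tuples D C f \<longleftrightarrow>
    (S, k) \<in> scope_tuples D S \<and> f (S, k) = Max (f ` scope_tuples D S)"
  using assms unfolding active_tuples_def scope_tuples_def by auto

text \<open>Both sides are finite sums over \<open>C\<close>, compared term by term, so they agree
  only if every term does, that is, if \<open>x\<close> picks an active tuple in each scope.\<close>

lemma objective_eq_upper_bound_iff:
  assumes x: "x \<in> assignments D V"
  shows "objective f x = upper_bound D C f \<longleftrightarrow> x \<in> SOL D V C (active_tuples D C f)"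
proof -
  have "objective f x = upper_bound D C f \<longleftrightarrow>
      (\<forall>S\<in>C. f (S, restrict x S) = Max (f ` scope_tuples D S))"
  proof
    assume "objective f x = upper_bound D C f"
    then have "(\<Sum>S\<in>C. f (S, restrict x S)) = (\<Sum>S\<in>C. Max (f ` scope_tuples D S))"
      unfolding objective_def upper_bound_def .
    then show "\<forall>S\<in>C. f (S, restrict x S) = Max (f ` scope_tuples D S)"
      using sum_mono_inv[of "\<lambda>S. f (S, restrict x S)" C "\<lambda>S. Max (f ` scope_tuples D S)"]
        le_Max_scope[OF restrict_scope_tuples[OF x]] finite_C by blast
  qed (simp add: objective_def upper_bound_def)
  then show ?thesis
    unfolding SOL_def using x restrict_scope_tuples by (auto simp: mem_active_tuples_iff)
qed

section \<open>Optimal solutions of the minimisation problem\<close>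

lemma sum_evenly_spread_objective: "(\<Sum>S\<in>C. objective g x / real (card C)) = objective g x"
\<comment> \<open>Without scopes the divisor \<open>card C\<close> is 0, but then both sides are
  empty sums.\<close>
proof (cases "C = {}")
  case True
  then show ?thesis
    unfolding objective_def by simp
qed (simp add: finite_C)

text \<open>Replaces minimality by an equation. Evaluating a feasible \<open>f'\<close> at
  \<open>x\<close> bounds its \<open>upper_bound\<close> below by \<open>objective g x\<close>, and
  the constant WCSP \<open>h\<close> attains this value.\<close>

lemma optimal_solution_iff:
  assumes x: "x \<in> OPT D V C g"
  shows "optimal_solution D V C g f \<longleftrightarrow>
    f \<in> wcsps D C \<and> super_reparametrization D V C f g \<and> upper_bound D C f = objective g x"
proof -
  have lower: "objective g x \<le> upper_bound D C f'" if "super_reparametrization D V C f' g" for f'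
    using that x objective_le_upper_bound[of x f']
    unfolding super_reparametrization_iff OPT_iff by force
  define h where "h = (\<lambda>t\<in>tuples D C. objective g x / real (card C))"
  have h: "h \<in> wcsps D C"
    unfolding h_def wcsps_def by simp
  have h_eq: "h t = objective g x / real (card C)" if "S \<in> C" "t \<in> scope_tuples D S" for S t
    using that scope_tuples_subset unfolding h_def by auto
  have "objective h y = objective g x" if "y \<in> assignments D V" for y
    using sum_evenly_spread_objective[of g x] h_eq[OF _ restrict_scope_tuples[OF that]]
    by (simp add: objective_def[of h])
  then have "super_reparametrization D V C h g"
    using x unfolding super_reparametrization_iff OPT_iff by simp
  moreover have "upper_bound D C h = objective g x"
  proof -
    have "Max (h ` scope_tuples D S) = objective g x / real (card C)" if S: "S \<in> C" for S
    proof -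
      \<comment> \<open>The restriction of \<open>x\<close> shows that the scope has a tuple, so the
        image is not empty.\<close>
      have "h ` scope_tuples D S = {objective g x / real (card C)}"
        using h_eq[OF S] restrict_scope_tuples[OF _ S] x unfolding OPT_iff by force
      then show ?thesis
        by simp
    qed
    then show ?thesis
      using sum_evenly_spread_objective[of g x] by (simp add: upper_bound_def)
  qed
  ultimately show ?thesis
    using h lower unfolding optimal_solution_def is_arg_min_linorder
    by (metis order_antisym)
qed

text \<open>At a maximiser \<open>x\<close> of \<open>g\<close> the chain
  \<open>objective g x\<close> \<le> \<open>objective f x\<close> \<le>
  \<open>upper_bound D C f\<close> has equal ends. The bound is therefore attained, and the
  maximisers of \<open>f\<close> are the assignments attaining it.\<close>

lemma OPT_optimal_solution:
  assumes f: "optimal_solution D V C g f"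
  shows "OPT D V C f = SOL D V C (active_tuples D C f)"
proof -
  obtain x where x: "x \<in> OPT D V C g"
    using OPT_nonempty by blast
  then have xa: "x \<in> assignments D V"
    by (simp add: OPT_iff)
  have "objective g x \<le> objective f x" "upper_bound D C f = objective g x"
    using f xa unfolding optimal_solution_iff[OF x] super_reparametrization_iff by auto
  then have attained: "objective f x = upper_bound D C f"
    using objective_le_upper_bound[OF xa, of f] by simp
  have "y \<in> OPT D V C f \<longleftrightarrow> objective f y = upper_bound D C f" if "y \<in> assignments D V" for y
    using that xa attained objective_le_upper_bound unfolding OPT_iff by (metis order_antisym)
  moreover have "SOL D V C (active_tuples D C f) \<subseteq> assignments D V"
    unfolding SOL_def by blast
  ultimately show ?thesis
    using objective_eq_upper_bound_iff[of _ f] OPT_subset[of f] by blast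
qed

section \<open>Tuple sets as CSPs, and the minimal CSP\<close>

lemma active_tuples_subset: "active_tuples D C f \<subseteq> tuples D C"
  unfolding active_tuples_def tuples_def by blast

text \<open>A CSP that has all of \<open>X\<close> among its solutions must allow each restriction
  of a member of \<open>X\<close>, and these restrictions alone already form such a CSP.\<close>

lemma A_min_eq:
  assumes "X \<subseteq> assignments D V"
  shows "A_min D V C X = {(S, restrict x S) | S x. S \<in> C \<and> x \<in> X}" (is "_ = ?R")
proof
  have "?R \<subseteq> tuples D C"
    using assms restrict_scope_tuples scope_tuples_subset by fastforce
  moreover have "X \<subseteq> SOL D V C ?R"
    using assms unfolding SOL_def by blast
  ultimately show "A_min D V C X \<subseteq> ?R"
    unfolding A_min_def by blast
  show "?R \<subseteq> A_min D V C X"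
    unfolding A_min_def SOL_def by blast
qed

lemma A_min_subset_tuples:
  assumes "X \<subseteq> assignments D V"
  shows "A_min D V C X \<subseteq> tuples D C"
  using assms restrict_scope_tuples scope_tuples_subset unfolding A_min_eq[OF assms] by fastforce

text \<open>\<open>A\<close> is one of the intersected CSPs and \<open>SOL\<close> is monotone, so
  no solutions are gained; none are lost because the minimal CSP allows all their
  restrictions.\<close>

lemma SOL_A_min:
  assumes "A \<subseteq> tuples D C"
  shows "SOL D V C (A_min D V C (SOL D V C A)) = SOL D V C A"
proof
  have "A_min D V C (SOL D V C A) \<subseteq> A"
    using assms unfolding A_min_def by blast
  then show "SOL D V C (A_min D V C (SOL D V C A)) \<subseteq> SOL D V C A"
    unfolding SOL_def by blast
  show "SOL D V C A \<subseteq> SOL D V C (A_min D V C (SOL D V C A))"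
    by (subst A_min_eq) (auto simp: SOL_def)
qed

section \<open>The optimality gap and the optimal solution built from it\<close>

lemma OPT_gap:
  assumes x: "x \<in> OPT D V C g"
  obtains e where "e > 0"
    and "\<And>y. y \<in> assignments D V \<Longrightarrow> y \<notin> OPT D V C g \<Longrightarrow> objective g y \<le> objective g x - e"
proof
  \<comment> \<open>The extra 1 keeps the set nonempty, with positive minimum, when every assignment
    is optimal.\<close>
  let ?E = "insert 1 ((\<lambda>y. objective g x - objective g y) ` (assignments D V - OPT D V C g))"
  have fin: "finite ?E"
    using finite_assignments by simp
  have "objective g y < objective g x" if y: "y \<in> assignments D V - OPT D V C g" for y
  proof (rule ccontr)
    assume "\<not> objective g y < objective g x"
    then have "objective g z \<le> objective g y" if "z \<in> assignments D V" for z
      using that x unfolding OPT_iff by force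
    then show False
      using y OPT_iff[of y g] by blast
  qed
  then show "Min ?E > 0"
    using fin by simp
  fix y assume "y \<in> assignments D V" "y \<notin> OPT D V C g"
  then have "Min ?E \<le> objective g x - objective g y"
    using fin by (intro Min_le) auto
  then show "objective g y \<le> objective g x - Min ?E"
    by simp
qed

lemma exists_optimal_with_minimal_active_tuples:
  assumes sol: "OPT D V C g = SOL D V C (A_min D V C (OPT D V C g))" (is "_ = SOL D V C ?A")
  obtains f where "optimal_solution D V C g f" and "active_tuples D C f = ?A"
proof -
  obtain x where x: "x \<in> OPT D V C g"
    using OPT_nonempty by blast
  then have xa: "x \<in> assignments D V"
    by (simp add: OPT_iff)
  obtain e where e: "e > 0"
    and gap: "\<And>y. y \<in> assignments D V \<Longrightarrow> y \<notin> OPT D V C g \<Longrightarrow> objective g y \<le> objective g x - e"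
    using OPT_gap[OF x] by blast
  define c where "c = objective g x / real (card C)"
  define d where "d = e / real (card C)"
  \<comment> \<open>An assignment loses at most \<open>d\<close> per scope, hence at most
    \<open>e\<close> in total, which the gap absorbs if it is not optimal for \<open>g\<close>; the
    optimal ones use only tuples of \<open>?A\<close> and lose nothing.\<close>
  define f where "f = (\<lambda>t\<in>tuples D C. if t \<in> ?A then c else c - d)"
  have d: "d > 0" if "S \<in> C" for S
    using that e finite_C card_gt_0_iff[of C] unfolding d_def by (intro divide_pos_pos) auto
  have f_eq: "f t = (if t \<in> ?A then c else c - d)" if "S \<in> C" "t \<in> scope_tuples D S" for S t
    using that scope_tuples_subset unfolding f_def by auto
  have sum_c: "(\<Sum>S\<in>C. c) = objective g x"
    unfolding c_def by (rule sum_evenly_spread_objective)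
  \<comment> \<open>Stated as an inequality because the sum is 0 rather than \<open>e\<close> when
    \<open>C\<close> is empty.\<close>
  have sum_d: "(\<Sum>S\<in>C. d) \<le> e"
    using e unfolding d_def by simp
  \<comment> \<open>The optimal \<open>x\<close> supplies a tuple of value \<open>c\<close> in every
    scope, so the lowered tuples are never active.\<close>
  have x_in: "(S, restrict x S) \<in> ?A" if "S \<in> C" for S
    using that x unfolding A_min_eq[OF OPT_subset] by blast
  have max_f: "Max (f ` scope_tuples D S) = c" if S: "S \<in> C" for S
  proof (rule Max_eqI)
    show "c \<in> f ` scope_tuples D S"
      using f_eq[OF S restrict_scope_tuples[OF xa S]] x_in[OF S] restrict_scope_tuples[OF xa S]
      by (metis imageI)
  qed (use f_eq[OF S] d[OF S] finite_scope_tuples[OF S] in auto)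
  have active: "active_tuples D C f = ?A"
  proof -
    have "t \<in> active_tuples D C f \<longleftrightarrow> t \<in> ?A" if t: "t \<in> tuples D C" for t
    proof -
      obtain S where S: "S \<in> C" and tS: "t \<in> scope_tuples D S"
        using t unfolding tuples_def by blast
      then obtain k where k: "t = (S, k)"
        unfolding scope_tuples_def by blast
      show ?thesis
        using f_eq[OF S tS] d[OF S] tS max_f[OF S] unfolding k mem_active_tuples_iff[OF S] by auto
    qed
    then show ?thesis
      using active_tuples_subset A_min_subset_tuples[OF OPT_subset] by blast
  qed
  have bound: "upper_bound D C f = objective g x"
    using max_f sum_c unfolding upper_bound_def by simp
  have "objective g y \<le> objective f y" if y: "y \<in> assignments D V" for y
  proof (cases "y \<in> OPT D V C g")
    case True
    then have "y \<in> SOL D V C (active_tuples D C f)"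
      using sol active by simp
    then have "objective f y = objective g x"
      using objective_eq_upper_bound_iff[OF y, of f] bound by simp
    then show ?thesis
      using x y unfolding OPT_iff by simp
  next
    case False
    have "objective g x - e \<le> (\<Sum>S\<in>C. c - d)"
      using sum_c sum_d by (simp only: sum_subtractf)
    also have "\<dots> \<le> objective f y"
      unfolding objective_def
    proof (rule sum_mono)
      fix S assume S: "S \<in> C"
      show "c - d \<le> f (S, restrict y S)"
        using f_eq[OF S restrict_scope_tuples[OF y S]] d[OF S] by simp
    qed
    finally show ?thesis
      using gap[OF y False] by simp
  qed
  then have "optimal_solution D V C g f"
    unfolding optimal_solution_iff[OF x] super_reparametrization_iff
    using bound by (simp add: wcsps_def f_def)
  then show thesis
    using active that by blast
qed

end

theorem theorem11:
  fixes D :: "'d set" and V :: "'v set" and C :: "'v set set"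
    and g :: "('v, 'd) tup \<Rightarrow> real"
  assumes "finite V" and "finite D" and "D \<noteq> {}"
    and "C \<subseteq> Pow V" and "{} \<notin> C"
    and "g \<in> wcsps D C"
  shows
    "((\<exists>A. A \<subseteq> tuples D C \<and> OPT D V C g = SOL D V C A) \<longleftrightarrow>
      (\<exists>f. optimal_solution D V C g f \<and> OPT D V C g = OPT D V C f))
     \<and>
     ((\<exists>A. A \<subseteq> tuples D C \<and> OPT D V C g = SOL D V C A) \<and>
      (\<exists>f. optimal_solution D V C g f \<and> OPT D V C g = OPT D V C f) \<longrightarrow>
        A_min D V C (OPT D V C g) \<subseteq> tuples D C \<and>
        OPT D V C g = SOL D V C (A_min D V C (OPT D V C g)) \<and>
        (\<exists>f. optimal_solution D V C g f \<and>
             active_tuples D C f = A_min D V C (OPT D V C g)) \<and>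
        (\<forall>f. optimal_solution D V C g f \<and>
             active_tuples D C f = A_min D V C (OPT D V C g) \<longrightarrow>
             OPT D V C g = OPT D V C f))"
proof -
  interpret csp_structure D V C
    using assms by unfold_locales auto
  let ?a = "\<exists>A. A \<subseteq> tuples D C \<and> OPT D V C g = SOL D V C A"
  let ?b = "\<exists>f. optimal_solution D V C g f \<and> OPT D V C g = OPT D V C f"
  let ?A = "A_min D V C (OPT D V C g)"
  have A_min_sol: "OPT D V C g = SOL D V C ?A" if ?a
    using that SOL_A_min by metis
  have ex: "\<exists>f. optimal_solution D V C g f \<and> active_tuples D C f = ?A" if ?a
    using exists_optimal_with_minimal_active_tuples[OF A_min_sol[OF that]] by blast
  \<comment> \<open>Equal active tuples give equal solution sets, so this covers every such optimal
    \<open>f\<close>, not only the constructed one.\<close>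
  have all: "OPT D V C g = OPT D V C f"
    if ?a "optimal_solution D V C g f" "active_tuples D C f = ?A" for f
    using A_min_sol[OF that(1)] OPT_optimal_solution[OF that(2)] that(3) by simp
  \<comment> \<open>The witness for \<open>A\<close> is \<open>active_tuples D C f\<close>.\<close>
  have b_imp_a: "?a" if "optimal_solution D V C g f" "OPT D V C g = OPT D V C f" for f
    using OPT_optimal_solution[OF that(1)] that(2) active_tuples_subset by metis
  have "?b" if ?a
    using ex[OF that] all[OF that] by blast
  with b_imp_a have equiv: "?a \<longleftrightarrow> ?b"
    by blast
  show ?thesis
  proof (intro conjI impI)
    assume "?a \<and> ?b"
    then have a: ?a
      by (rule conjunct1)
    show "OPT D V C g = SOL D V C ?A"
      by (rule A_min_sol[OF a])
    show "\<exists>f. optimal_solution D V C g f \<and> active_tuples D C f = ?A"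
      by (rule ex[OF a])
    show "\<forall>f. optimal_solution D V C g f \<and> active_tuples D C f = ?A \<longrightarrow> OPT D V C g = OPT D V C f"
      using all[OF a] by simp
    show "?A \<subseteq> tuples D C"
      by (rule A_min_subset_tuples[OF OPT_subset])
  qed (fact equiv)
qed

end
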